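(* Let $m\ge 1$ be an integer and let $\Sigma=\{\sigma_{ij}\}$ be an $m\times m$ (symmetric) positive semidefinite matrix with $\sigma_{jj}>0$ for all $j=1,\ldots,m$. Let $X=(X_1,\ldots,X_m)$ and $Y=(Y_1,\ldots,Y_m)$ be independent random vectors, each distributed as $\mathrm{N}(0,\Sigma)$. Let $\vec{w}=(w_1,\ldots,w_m)$ be a random vector that is independent of $(X,Y)$ and satisfies $w_j\ge 0$ for $j=1,\ldots,m$ and $\sum_{j=1}^m w_j=1$. Then the random variable $$Z=\sum_{j=1}^m w_j\,\frac{X_j}{Y_j}$$ has the $\mathrm{Cauchy}(0,1)$ distribution.
   Context: $\mathrm{N}(0,\Sigma)$ denotes the (possibly degenerate) centered multivariate Gaussian distribution on $\mathbb{R}^m$ with covariance matrix $\Sigma$; $\Sigma$ is allowed to be singular. $\mathrm{Cauchy}(0,1)$ is the distribution on $\mathbb{R}$ with density $\pi^{-1}(1+z^2)^{-1}$. Since $\sigma_{jj}>0$, each $Y_j$ is nonzero almost surely, so $Z$ is defined almost surely. The vector $\vec{w}$ may in particular be a deterministic constant. *)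

theory Defs
  imports "HOL-Probability.Probability"
begin

definition positive_semidefinite :: "real ^ 'm ^ 'm \<Rightarrow> bool" where
  "positive_semidefinite S \<longleftrightarrow> transpose S = S \<and> (\<forall>x. 0 \<le> x \<bullet> (S *v x))"

text \<open>
  The normal law on the line with mean \<open>\<mu>\<close> and standard deviation \<open>\<sigma> \<ge> 0\<close>.  For \<open>\<sigma> = 0\<close> it is the
  point mass at \<open>\<mu>\<close>, where the density \<^const>\<open>normal_density\<close> would be identically zero.
\<close>
definition normal_law :: "real \<Rightarrow> real \<Rightarrow> real measure" where
  "normal_law \<mu> \<sigma> =
     (if \<sigma> = 0 then return borel \<mu> else density lborel (\<lambda>x. ennreal (normal_density \<mu> \<sigma> x)))"

text \<open>
  A possibly degenerate Gaussian law on Euclidean space: all linear functionals are normal.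
  In particular all coordinates have moments of every order, so the Bochner integrals in
  \<open>centered_gaussian\<close> are never junk values.
\<close>
definition gaussian_law :: "(real ^ 'm) measure \<Rightarrow> bool" where
  "gaussian_law N \<longleftrightarrow> sets N = sets borel \<and>
     (\<forall>t. \<exists>\<mu> \<sigma>. 0 \<le> \<sigma> \<and> distr N borel (\<lambda>x. t \<bullet> x) = normal_law \<mu> \<sigma>)"

text \<open>\<open>N\<close> is the law \<open>N(0, S)\<close>; the mean being zero, the covariances are the mixed second moments.\<close>
definition centered_gaussian :: "real ^ 'm ^ 'm \<Rightarrow> (real ^ 'm) measure \<Rightarrow> bool" where
  "centered_gaussian S N \<longleftrightarrow> gaussian_law N \<and>
     (\<forall>i. (\<integral>x. x $ i \<partial>N) = 0) \<and>
     (\<forall>i j. (\<integral>x. x $ i * x $ j \<partial>N) = S $ i $ j)"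

text \<open>
  Independence of two random variables with values in different types, which
  \<^const>\<open>prob_space.indep_var\<close> does not admit: the generated \<open>\<sigma>\<close>-algebras are independent.
\<close>
definition indep_rv ::
  "'a measure \<Rightarrow> 'b measure \<Rightarrow> ('a \<Rightarrow> 'b) \<Rightarrow> 'c measure \<Rightarrow> ('a \<Rightarrow> 'c) \<Rightarrow> bool" where
  "indep_rv M S U T V \<longleftrightarrow> U \<in> measurable M S \<and> V \<in> measurable M T \<and>
     prob_space.indep_set M {U -` A \<inter> space M | A. A \<in> sets S} {V -` B \<inter> space M | B. B \<in> sets T}"

definition cauchy_density :: "real \<Rightarrow> real" where
  "cauchy_density z = 1 / (pi * (1 + z\<^sup>2))"

end

theory Submission
  imports Defs "HOL-Complex_Analysis.Cauchy_Integral_Formula"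
begin

text \<open>
  Let \<open>X\<close> and \<open>Y\<close> be independent with law \<open>N(0, \<Sigma>)\<close>.  The pair is rotation invariant: for every angle
  \<open>\<theta>\<close>, turning all plane vectors \<open>(X\<^sub>j, Y\<^sub>j)\<close> by the same \<open>\<theta>\<close> preserves the joint law
  (lemma \<open>distr_turn_gaussian_pair\<close>).  So \<open>\<theta>\<close> may be taken uniform and independent of everything else.
  Then condition on \<open>X\<close>, \<open>Y\<close> and the weights, and let only \<open>\<theta>\<close> vary.

  The ratio of the coordinates of the turned vector is \<open>cot (\<alpha>\<^sub>j + \<theta>)\<close>, where \<open>\<alpha>\<^sub>j\<close> is the argument of the
  vector.  As a function of \<open>z = e\<^sup>2\<^sup>i\<^sup>\<theta>\<close> on the unit circle it is \<open>\<i>\<close> times the boundary value of a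
  Cayley transform that maps the disc to the left half-plane and \<open>0\<close> to \<open>-1\<close>.  A convex
  combination of such transforms has the same two properties.  For \<open>s \<ge> 0\<close> the exponential of \<open>s\<close> times
  this combination is therefore bounded and holomorphic in the disc with value \<open>exp (- s)\<close> at \<open>0\<close>, and
  the mean value property shows that the convex combination of cotangents has the characteristic
  function \<open>exp (- \<bar>t\<bar>)\<close> (lemma \<open>mean_turned_ratios\<close>).  Neither the arguments nor the weights enter the
  result, so the correlations in \<open>\<Sigma>\<close> and the law of the weights disappear.  The case of one vector,
  where the ratio is the cotangent of a uniform angle, is the Cauchy law itself (lemma
  \<open>char_cauchy\<close>), and characteristic functions determine laws on the line.

  Rotation invariance needs the fact that a finite measure on a Euclidean space is determined by its
  characteristic function (theorem \<open>euclidean_measure_eq_if_char_eq\<close>).  It is obtained from the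
  one-dimensional Levy theorem by induction over the coordinates.
\<close>

section \<open>Finite measures are determined by their characteristic functions\<close>

text \<open>
  The Levy uniqueness theorem for probability measures extends to finite measures by normalising,
  since the total mass is the value of the characteristic function at \<open>0\<close>.
\<close>
lemma finite_measure_eq_if_char_eq:
  fixes M N :: "real measure"
  assumes "finite_measure M" "finite_measure N"
    and sM: "sets M = sets borel" and sN: "sets N = sets borel"
    and ch: "\<And>t. char M t = char N t"
  shows "M = N"
proof -
  interpret M: finite_measure M by fact
  interpret N: finite_measure N by fact
  have spM: "space M = UNIV" and spN: "space N = UNIV"
    using sM sN sets_eq_imp_space_eq[of _ borel] by auto
  have tot: "measure M UNIV = measure N UNIV"
    using ch[of 0] by (simp add: char_def spM spN)
  show ?thesis
  proof (cases "measure M UNIV = 0")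
    case True
    have "emeasure M A = emeasure N A" for A
    proof -
      have "measure M A \<le> measure M (space M)" "measure N A \<le> measure N (space N)"
        by (rule M.bounded_measure N.bounded_measure)+
      then have "measure M A = 0" "measure N A = 0"
        using True tot by (simp_all add: spM spN measure_le_0_iff)
      then show ?thesis by (simp add: M.emeasure_eq_measure N.emeasure_eq_measure)
    qed
    then show ?thesis using sM sN by (intro measure_eqI) auto
  next
    case False
    define c where "c = measure M UNIV"
    have c: "c > 0" using False by (simp add: c_def zero_less_measure_iff)
    have norm: "real_distribution (density K (\<lambda>_. ennreal (1/c))) \<and>
          (\<forall>t. char (density K (\<lambda>_. ennreal (1/c))) t = char K t / c)"
      if "finite_measure K" "sets K = sets borel" "measure K UNIV = c" for K
    proof (intro conjI allI)
      interpret K: finite_measure K by fact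
      have sp: "space K = UNIV" using that sets_eq_imp_space_eq[of K borel] by simp
      have "emeasure (density K (\<lambda>_. ennreal (1/c))) UNIV = 1"
        using c that sp by (simp add: emeasure_density K.emeasure_eq_measure
            flip: ennreal_mult')
      then show "real_distribution (density K (\<lambda>_. ennreal (1/c)))"
        unfolding real_distribution_def real_distribution_axioms_def
        using sp that by (auto intro!: prob_spaceI)
      show "char (density K (\<lambda>_. ennreal (1/c))) t = char K t / c" for t
        unfolding char_def using c that(2)
        by (subst integral_density) (auto simp: scaleR_conv_of_real divide_simps measurable_cong_sets[OF that(2) refl])
    qed
    have "density M (\<lambda>_. ennreal (1/c)) = density N (\<lambda>_. ennreal (1/c))"
      using norm[of M] norm[of N] assms tot ch
      by (intro Levy_uniqueness) (auto simp: c_def)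
    then have "density (density M (\<lambda>_. ennreal (1/c))) (\<lambda>_. ennreal c)
        = density (density N (\<lambda>_. ennreal (1/c))) (\<lambda>_. ennreal c)"
      by simp
    then show ?thesis using c
      by (simp add: density_density_eq density_1 flip: ennreal_mult')
  qed
qed

text \<open>
  Uniqueness for the signed measure with density \<open>g\<close>: the weights \<open>1 + g\<close> and \<open>1\<close> are
  nonnegative, so the one-dimensional theorem applies to the image under \<open>f\<close> of either measure, and
  the two conclusions are subtracted.
\<close>
lemma integral_indicator_eq_if_weighted_char_eq:
  fixes f g :: "'a \<Rightarrow> real"
  assumes "finite_measure M" "finite_measure N" and s: "sets M = sets N"
    and f [measurable]: "f \<in> borel_measurable M" and g [measurable]: "g \<in> borel_measurable M"
    and bd: "\<And>x. \<bar>g x\<bar> \<le> 1"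
    and ch: "\<And>t. (\<integral>x. iexp (t * f x) \<partial>M) = (\<integral>x. iexp (t * f x) \<partial>N)"
    and chg: "\<And>t. (\<integral>x. g x *\<^sub>R iexp (t * f x) \<partial>M) = (\<integral>x. g x *\<^sub>R iexp (t * f x) \<partial>N)"
    and A: "A \<in> sets borel"
  shows "(\<integral>x. indicator A (f x) * g x \<partial>M) = (\<integral>x. indicator A (f x) * g x \<partial>N)"
proof -
  interpret M: finite_measure M by fact
  interpret N: finite_measure N by fact
  note [measurable_cong] = s[symmetric]
  note [measurable] = A
  have *: "(\<integral>x. indicator A (f x) * (1 + h x) \<partial>M) = (\<integral>x. indicator A (f x) * (1 + h x) \<partial>N)"
    if h [measurable]: "h \<in> borel_measurable M" and hb: "\<And>x. \<bar>h x\<bar> \<le> 1"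
      and chh: "\<And>t. (\<integral>x. h x *\<^sub>R iexp (t * f x) \<partial>M) = (\<integral>x. h x *\<^sub>R iexp (t * f x) \<partial>N)" for h
  proof -
    have pos: "0 \<le> 1 + h x" for x using hb[of x] by linarith
    let ?D = "\<lambda>K. distr (density K (\<lambda>x. ennreal (1 + h x))) borel f"
    have fin: "finite_measure (?D K)" and
      intg: "integrable K (\<lambda>x. iexp (t * f x))" "integrable K (\<lambda>x. h x *\<^sub>R iexp (t * f x))" and
      chr: "char (?D K) t = (\<integral>x. iexp (t * f x) \<partial>K) + (\<integral>x. h x *\<^sub>R iexp (t * f x) \<partial>K)" and
      ms: "measure (?D K) A = (\<integral>x. indicator A (f x) * (1 + h x) \<partial>K)"
      if K: "finite_measure K" "sets K = sets M" for K t
    proof -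
      interpret K: finite_measure K by fact
      note [measurable_cong] = K(2)
      have ib: "integrable K (\<lambda>x. 1 + h x)"
        using hb by (intro K.integrable_const_bound[where B=2]) (auto intro!: AE_I2 order_trans[OF abs_triangle_ineq] add_mono[of 1 1 _ 1, simplified])
      have "emeasure (density K (\<lambda>x. ennreal (1 + h x))) (space K) = ennreal (\<integral>x. 1 + h x \<partial>K)"
        using ib pos by (subst emeasure_density) (auto simp: nn_integral_eq_integral[symmetric] intro!: nn_integral_cong)
      then interpret D: finite_measure "density K (\<lambda>x. ennreal (1 + h x))"
        by (intro finite_measureI) simp
      show "finite_measure (?D K)" by (rule D.finite_measure_distr) simp
      show i1: "integrable K (\<lambda>x. iexp (t * f x))"
        by (intro K.integrable_const_bound[where B=1]) auto
      show i2: "integrable K (\<lambda>x. h x *\<^sub>R iexp (t * f x))"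
        using hb by (intro K.integrable_const_bound[where B=1]) auto
      show "char (?D K) t = (\<integral>x. iexp (t * f x) \<partial>K) + (\<integral>x. h x *\<^sub>R iexp (t * f x) \<partial>K)"
        unfolding char_def using pos
        by (subst integral_distr, simp, simp, subst integral_density)
          (simp_all add: scaleR_add_left Bochner_Integration.integral_add[OF i1[simplified] i2[simplified]])
      have "measure (?D K) A = (\<integral>x. indicator A x \<partial>?D K)" by simp
      also have "\<dots> = (\<integral>x. indicator A (f x) * (1 + h x) \<partial>K)"
        using pos by (subst integral_distr, simp, simp, subst integral_density) (auto simp: mult.commute)
      finally show "measure (?D K) A = (\<integral>x. indicator A (f x) * (1 + h x) \<partial>K)" .
    qed
    have "?D M = ?D N"
      by (rule finite_measure_eq_if_char_eq)
        (use fin[of M] fin[of N] chr[of M] chr[of N] s assms(1,2) ch chh in auto)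
    then show ?thesis using ms[of M] ms[of N] s assms(1,2) by simp
  qed
  have i: "integrable K (\<lambda>x. indicator A (f x) :: real)" "integrable K (\<lambda>x. indicator A (f x) * g x)"
    if K: "finite_measure K" "sets K = sets M" for K
  proof -
    interpret K: finite_measure K by fact
    note [measurable_cong] = K(2)
    show "integrable K (\<lambda>x. indicator A (f x) :: real)"
      by (intro K.integrable_const_bound[where B=1]) (auto split: split_indicator)
    show "integrable K (\<lambda>x. indicator A (f x) * g x)"
      using bd by (intro K.integrable_const_bound[where B=1]) (auto split: split_indicator)
  qed
  have "(\<integral>x. indicator A (f x) * (1 + g x) \<partial>M) = (\<integral>x. indicator A (f x) * (1 + g x) \<partial>N)"
    by (rule *[OF g bd chg])
  moreover have "(\<integral>x. indicator A (f x) * (1 + 0) \<partial>M) = (\<integral>x. indicator A (f x) * (1 + 0::real) \<partial>N)"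
    using *[of "\<lambda>_. 0"] by simp
  ultimately show ?thesis
    using i[of M] i[of N] s assms(1,2) by (simp add: distrib_left)
qed

text \<open>
  The step from one dimension to finitely many adds one function \<open>f j\<close> at a time.  With \<open>h\<close> a
  linear combination of the other functions, the weights \<open>cos h\<close> and \<open>sin h\<close> in the preceding lemma
  show that the measures restricted to \<open>f j \<in> A j\<close> still have equal joint characteristic functions of
  the other functions, and the induction hypothesis applies to these restricted measures.  This is why
  the induction has to run over all finite measures and not only over probability measures.
\<close>
lemma measure_cylinder_eq_if_char_eq:
  fixes f :: "'i \<Rightarrow> 'a \<Rightarrow> real"
  assumes "finite I" "finite_measure M" "finite_measure N" "sets M = sets N"
    and "\<And>i. i \<in> I \<Longrightarrow> f i \<in> borel_measurable M"
    and "\<And>t. (\<integral>x. iexp (\<Sum>i\<in>I. t i * f i x) \<partial>M) = (\<integral>x. iexp (\<Sum>i\<in>I. t i * f i x) \<partial>N)"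
    and "\<And>i. i \<in> I \<Longrightarrow> A i \<in> sets borel"
  shows "measure M {x \<in> space M. \<forall>i\<in>I. f i x \<in> A i} = measure N {x \<in> space N. \<forall>i\<in>I. f i x \<in> A i}"
  using assms
proof (induction I arbitrary: M N rule: finite_induct)
  case empty
  then show ?case by simp
next
  case (insert j I M N)
  interpret M: finite_measure M by fact
  interpret N: finite_measure N by fact
  note s = insert.prems(3)
  note [measurable_cong] = s[symmetric]
  have [measurable]: "f j \<in> borel_measurable M" "A j \<in> sets borel"
    using insert.prems(4,6)[of j] by simp_all
  have fI [measurable]: "f i \<in> borel_measurable M" if "i \<in> I" for i
    using insert.prems(4)[of i] that by simp
  define S where "S = f j -` A j \<inter> space M"
  have S [measurable]: "S \<in> sets M" unfolding S_def by measurable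
  let ?R = "\<lambda>K. density K (\<lambda>x. ennreal (indicator S x))"
  have fin: "finite_measure (?R K)" if K: "finite_measure K" "sets K = sets M" for K
  proof -
    interpret K: finite_measure K by fact
    have [measurable]: "S \<in> sets K" using S K by simp
    show ?thesis
      by (intro finite_measureI) (simp add: emeasure_restricted ennreal_indicator)
  qed
  have charI: "(\<integral>x. iexp (\<Sum>i\<in>I. t i * f i x) \<partial>?R M) = (\<integral>x. iexp (\<Sum>i\<in>I. t i * f i x) \<partial>?R N)" for t
  proof -
    define h where "h x = (\<Sum>i\<in>I. t i * f i x)" for x
    have [measurable]: "h \<in> borel_measurable M" unfolding h_def by measurable
    have joint: "(\<integral>x. iexp (c * f j x + d * h x) \<partial>M) = (\<integral>x. iexp (c * f j x + d * h x) \<partial>N)" for c d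
    proof -
      have "(\<Sum>i\<in>insert j I. (if i = j then c else d * t i) * f i x) = c * f j x + d * h x" for x
      proof -
        have "(\<Sum>i\<in>I. (if i = j then c else d * t i) * f i x) = d * h x"
          unfolding h_def sum_distrib_left using insert.hyps
          by (intro sum.cong) auto
        then show ?thesis using insert.hyps by simp
      qed
      then show ?thesis
        using insert.prems(5)[of "\<lambda>i. if i = j then c else d * t i"] by simp
    qed
    have integ: "integrable K (\<lambda>x. iexp (c * f j x + d * h x))"
      if K: "finite_measure K" "sets K = sets M" for K c d
    proof -
      interpret K: finite_measure K by fact
      note [measurable_cong] = K(2)
      show ?thesis by (intro K.integrable_const_bound[where B=1]) auto
    qed
    note int = integ[OF insert.prems(1) refl] integ[OF insert.prems(2) s[symmetric]]
    have ch: "(\<integral>x. iexp (c * f j x) \<partial>M) = (\<integral>x. iexp (c * f j x) \<partial>N)" for c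
      using joint[of c 0] by simp
    \<comment> \<open>Euler: both weighted exponentials are combinations of values of the joint characteristic function.\<close>
    have "cos a *\<^sub>R iexp b = (iexp (b + 1 * a) + iexp (b + (-1) * a)) / 2"
         "sin a *\<^sub>R iexp b = (iexp (b + 1 * a) - iexp (b + (-1) * a)) / (2 * \<i>)" for a b
      unfolding cis_conv_exp[symmetric]
      by (simp_all add: complex_eq_iff cos_add sin_add cos_diff sin_diff)
    note cosE = this(1)[of "h x" "c * f j x" for x c] and sinE = this(2)[of "h x" "c * f j x" for x c]
    have chcos: "(\<integral>x. cos (h x) *\<^sub>R iexp (c * f j x) \<partial>M) = (\<integral>x. cos (h x) *\<^sub>R iexp (c * f j x) \<partial>N)" for c
      unfolding cosE by (simp only: integral_divide_zero Bochner_Integration.integral_add int joint)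
    have chsin: "(\<integral>x. sin (h x) *\<^sub>R iexp (c * f j x) \<partial>M) = (\<integral>x. sin (h x) *\<^sub>R iexp (c * f j x) \<partial>N)" for c
      unfolding sinE by (simp only: integral_divide_zero Bochner_Integration.integral_diff int joint)
    have eq: "(\<integral>x. indicator (A j) (f j x) * cos (h x) \<partial>M) = (\<integral>x. indicator (A j) (f j x) * cos (h x) \<partial>N)"
             "(\<integral>x. indicator (A j) (f j x) * sin (h x) \<partial>M) = (\<integral>x. indicator (A j) (f j x) * sin (h x) \<partial>N)"
      by (rule integral_indicator_eq_if_weighted_char_eq; (fact | simp add: chcos chsin ch | measurable))+
    have "(\<integral>x. iexp (h x) \<partial>?R K)
        = Complex (\<integral>x. indicator (A j) (f j x) * cos (h x) \<partial>K) (\<integral>x. indicator (A j) (f j x) * sin (h x) \<partial>K)"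
      if K: "finite_measure K" "sets K = sets M" for K
    proof -
      interpret K: finite_measure K by fact
      note [measurable_cong] = K(2)
      have spK: "space K = space M" using K(2) by (rule sets_eq_imp_space_eq)
      have [simp]: "integrable K (\<lambda>x. indicator S x *\<^sub>R iexp (h x))"
        by (intro K.integrable_const_bound[where B=1]) (auto split: split_indicator)
      have "(\<integral>x. iexp (h x) \<partial>?R K) = (\<integral>x. indicator S x *\<^sub>R iexp (h x) \<partial>K)"
        by (subst integral_density) auto
      also have "\<dots> = Complex (\<integral>x. Re (indicator S x *\<^sub>R iexp (h x)) \<partial>K) (\<integral>x. Im (indicator S x *\<^sub>R iexp (h x)) \<partial>K)"
        by (simp add: complex_eq_iff flip: integral_Re integral_Im)
      also have "(\<integral>x. Re (indicator S x *\<^sub>R iexp (h x)) \<partial>K) = (\<integral>x. indicator (A j) (f j x) * cos (h x) \<partial>K)"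
        by (intro Bochner_Integration.integral_cong refl) (auto simp: S_def spK Re_exp split: split_indicator)
      also have "(\<integral>x. Im (indicator S x *\<^sub>R iexp (h x)) \<partial>K) = (\<integral>x. indicator (A j) (f j x) * sin (h x) \<partial>K)"
        by (intro Bochner_Integration.integral_cong refl) (auto simp: S_def spK Im_exp split: split_indicator)
      finally show ?thesis .
    qed
    from this[OF insert.prems(1) refl] this[OF insert.prems(2) s[symmetric]] show ?thesis
      unfolding h_def[symmetric] eq by simp
  qed
  have meas: "measure (?R K) {x \<in> space (?R K). \<forall>i\<in>I. f i x \<in> A i}
      = measure K {x \<in> space K. \<forall>i\<in>insert j I. f i x \<in> A i}"
    if K: "finite_measure K" "sets K = sets M" for K
  proof -
    interpret K: finite_measure K by fact
    note [measurable_cong] = K(2)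
    have spK: "space K = space M" using K(2) by (rule sets_eq_imp_space_eq)
    have [measurable]: "A i \<in> sets borel" if "i \<in> I" for i using insert.prems(6)[of i] that by simp
    have B: "{x \<in> space K. \<forall>i\<in>I. f i x \<in> A i} \<in> sets K"
      using insert.hyps by measurable
    have "S \<inter> {x \<in> space K. \<forall>i\<in>I. f i x \<in> A i} = {x \<in> space K. \<forall>i\<in>insert j I. f i x \<in> A i}"
      by (auto simp: S_def spK)
    then show ?thesis using B
      by (simp add: measure_def emeasure_restricted ennreal_indicator)
  qed
  have "measure (?R M) {x \<in> space (?R M). \<forall>i\<in>I. f i x \<in> A i}
      = measure (?R N) {x \<in> space (?R N). \<forall>i\<in>I. f i x \<in> A i}"
    by (rule insert.IH[OF _ _ _ _ charI]) (use insert.prems(1-4,6) fI in \<open>simp_all add: fin\<close>)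
  then show ?case
    using meas[OF insert.prems(1) refl] meas[OF insert.prems(2) s[symmetric]] by simp
qed

text \<open>
  Open boxes generate the Borel sets, and they are cylinders over the coordinate functions.
\<close>
theorem euclidean_measure_eq_if_char_eq:
  fixes M N :: "'a::euclidean_space measure"
  assumes "finite_measure M" "finite_measure N"
    and sM: "sets M = sets borel" and sN: "sets N = sets borel"
    and ch: "\<And>t. (\<integral>x. iexp (t \<bullet> x) \<partial>M) = (\<integral>x. iexp (t \<bullet> x) \<partial>N)"
  shows "M = N"
proof -
  interpret M: finite_measure M by fact
  interpret N: finite_measure N by fact
  have sp: "space M = UNIV" "space N = UNIV"
    using sM sN sets_eq_imp_space_eq[of _ borel] by auto
  have box: "emeasure M (box l u) = emeasure N (box l u)" for l u
  proof -
    have "measure M {x \<in> space M. \<forall>b\<in>Basis. x \<bullet> b \<in> {l \<bullet> b<..<u \<bullet> b}}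
        = measure N {x \<in> space N. \<forall>b\<in>Basis. x \<bullet> b \<in> {l \<bullet> b<..<u \<bullet> b}}"
    proof (rule measure_cylinder_eq_if_char_eq)
      fix t :: "'a \<Rightarrow> real"
      have "(\<Sum>b\<in>Basis. t b * (x \<bullet> b)) = (\<Sum>b\<in>Basis. t b *\<^sub>R b) \<bullet> x" for x
        by (simp add: inner_sum_left inner_commute[of x])
      then show "(\<integral>x. iexp (\<Sum>b\<in>Basis. t b * (x \<bullet> b)) \<partial>M) = (\<integral>x. iexp (\<Sum>b\<in>Basis. t b * (x \<bullet> b)) \<partial>N)"
        using ch by simp
    qed (use assms in \<open>auto simp: measurable_cong_sets[OF sM refl]\<close>)
    then show ?thesis
      by (simp add: M.emeasure_eq_measure N.emeasure_eq_measure sp box_def greaterThanLessThan_iff)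
  qed
  show ?thesis
  proof (rule measure_eqI_generator_eq)
    let ?E = "range (\<lambda>(a, b). box a b::'a set)"
    show "Int_stable ?E" by (auto simp: Int_stable_def box_Int_box)
    show "?E \<subseteq> Pow UNIV" "sets M = sigma_sets UNIV ?E" "sets N = sigma_sets UNIV ?E"
      by (simp_all add: borel_eq_box sM sN)
    let ?A = "\<lambda>n::nat. box (- (real n *\<^sub>R One)) (real n *\<^sub>R One) :: 'a set"
    show "range ?A \<subseteq> ?E" "(\<Union>i. ?A i) = UNIV"
      unfolding UN_box_eq_UNIV by auto
    show "emeasure M (?A i) \<noteq> \<infinity>" for i by auto
    show "emeasure M B = emeasure N B" if "B \<in> ?E" for B
      using that box by auto
  qed
qed

section \<open>Bounded holomorphic functions and turned ratios\<close>

abbreviation unit_uniform :: "real measure" where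
  "unit_uniform \<equiv> uniform_measure lborel {0..1}"

lemma integral_unit_uniform:
  fixes f :: "real \<Rightarrow> complex"
  assumes [measurable]: "f \<in> borel_measurable borel"
  shows "(\<integral>x. f x \<partial>unit_uniform) = (\<integral>x. indicator {0..1} x *\<^sub>R f x \<partial>lborel)"
proof -
  have "(\<integral>x. f x \<partial>unit_uniform) = (\<integral>x. f x \<partial>density lborel (\<lambda>x. ennreal (indicator {0..1} x)))"
    unfolding uniform_measure_def by (simp add: ennreal_indicator divide_ennreal_def)
  then show ?thesis by (simp add: integral_density)
qed

lemma prob_space_unit_uniform: "prob_space unit_uniform"
  by (rule prob_space_uniform_measure) auto

lemma mean_value_circle:
  assumes F: "F holomorphic_on ball 0 1" and r: "0 < r" "r < 1"
  shows "(\<integral>x. F (of_real r * cis (2 * pi * x)) \<partial>unit_uniform) = F 0"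
proof -
  define e where "e x = of_real r * cis (2 * pi * x)" for x
  have e_in: "e x \<in> ball 0 1" for x using r by (simp add: e_def norm_mult)
  have ce: "continuous_on A e" for A unfolding e_def by (intro continuous_intros)
  have cF: "continuous_on A (\<lambda>x. F (e x))" for A
    by (rule continuous_on_compose2[OF holomorphic_on_imp_continuous_on[OF F] ce])
      (use e_in in blast)
  have circ: "circlepath 0 r x = e x" for x
    by (simp add: circlepath e_def cis_conv_exp mult_ac)
  have "((\<lambda>u. F u / (u - 0)) has_contour_integral 2 * of_real pi * \<i> * F 0) (circlepath 0 r)"
    by (rule Cauchy_integral_circlepath_simple) (use r in \<open>auto intro: holomorphic_on_subset[OF F]\<close>)
  then have "((\<lambda>x. F (e x) / e x * (2 * pi * \<i> * e x)) has_integral 2 * of_real pi * \<i> * F 0) {0..1}"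
    unfolding has_contour_integral
    by (rule has_integral_eq[rotated]) (auto simp: circ vector_derivative_circlepath01 vector_derivative_circlepath e_def cis_conv_exp mult_ac)
  then have "((\<lambda>x. (2 * of_real pi * \<i>) * F (e x)) has_integral (2 * of_real pi * \<i>) * F 0) {0..1}"
    by (rule has_integral_eq[rotated]) (use r in \<open>auto simp: e_def\<close>)
  then have "((\<lambda>x. F (e x)) has_integral F 0) {0..1}"
    by (drule_tac c="1 / (2 * of_real pi * \<i>)" in has_integral_mult_right) simp
  then have "integral {0..1} (\<lambda>x. F (e x)) = F 0" by blast
  moreover have "set_integrable lborel {0..1} (\<lambda>x. F (e x))"
    by (rule borel_integrable_atLeastAtMost'[OF cF])
  ultimately have "(\<integral>x. indicator {0..1} x *\<^sub>R F (e x) \<partial>lborel) = F 0"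
    using set_borel_integral_eq_integral(2)[of "{0..1}" "\<lambda>x. F (e x)"] by (simp add: set_lebesgue_integral_def)
  then show ?thesis unfolding e_def[symmetric]
    by (subst integral_unit_uniform) (auto intro: borel_measurable_continuous_onI cF)
qed

text \<open>
  The mean value property on the unit circle for a bounded holomorphic function that need not extend
  continuously to the boundary: boundary values almost everywhere suffice, by dominated convergence
  along circles whose radii increase to \<open>1\<close>.
\<close>
lemma mean_value_boundary:
  assumes F: "F holomorphic_on ball 0 1" and bd: "\<And>z. z \<in> ball 0 1 \<Longrightarrow> norm (F z) \<le> B"
    and G [measurable]: "G \<in> borel_measurable borel"
    and lim: "AE x in lborel. ((\<lambda>z. F z) \<longlongrightarrow> G x) (at (cis (2 * pi * x)) within ball 0 1)"
  shows "(\<integral>x. G x \<partial>unit_uniform) = F 0"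
proof -
  interpret prob_space unit_uniform by (rule prob_space_unit_uniform)
  define r where "r n = 1 - 1 / (real n + 2)" for n
  have r: "0 < r n" "r n < 1" for n by (auto simp: r_def field_simps)
  have rlim: "r \<longlonglongrightarrow> 1" unfolding r_def by real_asymp
  define e where "e n x = of_real (r n) * cis (2 * pi * x)" for n x
  have e_in: "e n x \<in> ball 0 1" for n x using r[of n] by (simp add: e_def norm_mult)
  have e_ne: "e n x \<noteq> cis (2 * pi * x)" for n x
  proof
    assume "e n x = cis (2 * pi * x)"
    then have "norm (e n x) = 1" by simp
    then show False using r[of n] by (simp add: e_def norm_mult)
  qed
  have cF: "continuous_on UNIV (\<lambda>x. F (e n x))" for n
  proof (rule continuous_on_compose2[OF holomorphic_on_imp_continuous_on[OF F]])
    show "continuous_on UNIV (e n)" unfolding e_def by (intro continuous_intros)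
  qed (use e_in in auto)
  have "(\<lambda>n. \<integral>x. F (e n x) \<partial>unit_uniform) \<longlonglongrightarrow> (\<integral>x. G x \<partial>unit_uniform)"
  proof (rule integral_dominated_convergence[where w="\<lambda>_. B"])
    show "AE x in unit_uniform. (\<lambda>n. F (e n x)) \<longlonglongrightarrow> G x"
    proof (rule AE_uniform_measureI)
      show "AE x in lborel. x \<in> {0..1} \<longrightarrow> (\<lambda>n. F (e n x)) \<longlonglongrightarrow> G x"
        using lim
      proof eventually_elim
        case (elim x)
        have "(\<lambda>n. e n x) \<longlonglongrightarrow> of_real 1 * cis (2 * pi * x)"
          unfolding e_def by (intro tendsto_intros rlim)
        then have "filterlim (\<lambda>n. e n x) (at (cis (2 * pi * x)) within ball 0 1) sequentially"
          using e_in e_ne by (auto simp: filterlim_at)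
        from filterlim_compose[OF elim this] show ?case by simp
      qed
    qed simp
    show "AE x in unit_uniform. norm (F (e n x)) \<le> B" for n
      using bd e_in by auto
    show "(\<lambda>x. F (e n x)) \<in> borel_measurable unit_uniform" for n
      using borel_measurable_continuous_onI[OF cF] by simp
  qed auto
  moreover have "(\<integral>x. F (e n x) \<partial>unit_uniform) = F 0" for n
    unfolding e_def by (rule mean_value_circle[OF F r])
  ultimately show ?thesis by (simp add: LIMSEQ_const_iff)
qed

text \<open>
  The quotient of the real and imaginary parts of \<open>(p + \<i> q) e\<^sup>i\<^sup>\<theta>\<close>, that is the quotient of the
  coordinates of the vector \<open>(p, q)\<close> turned by the angle \<open>\<theta>\<close>.
\<close>
definition turned_ratio :: "real \<Rightarrow> real \<Rightarrow> real \<Rightarrow> real" where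
  "turned_ratio \<theta> p q = (p * cos \<theta> - q * sin \<theta>) / (p * sin \<theta> + q * cos \<theta>)"

text \<open>
  With \<open>\<alpha>\<close> the argument of \<open>p + \<i> q\<close>, the expression is a nonzero multiple of \<open>sin (\<alpha> + \<pi> x)\<close>,
  which has countably many zeros.
\<close>
lemma AE_turned_denominator_nonzero:
  assumes "p \<noteq> 0 \<or> q \<noteq> 0"
  shows "AE x in lborel. p * sin (pi * x) + q * cos (pi * x) \<noteq> 0"
proof -
  define a where "a = Complex p q"
  have a: "a \<noteq> 0" using assms by (auto simp: a_def complex_eq_iff)
  have "p = cmod a * cos (Arg a)" "q = cmod a * sin (Arg a)"
    using Re_rcis[of "cmod a" "Arg a"] Im_rcis[of "cmod a" "Arg a"] by (simp_all add: rcis_cmod_Arg a_def)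
  then have eq: "p * sin (pi * x) + q * cos (pi * x) = cmod a * sin (Arg a + pi * x)" for x
    by (simp add: sin_add algebra_simps)
  have "{x. p * sin (pi * x) + q * cos (pi * x) = 0} \<subseteq> range (\<lambda>i::int. i - Arg a / pi)"
  proof
    fix x assume "x \<in> {x. p * sin (pi * x) + q * cos (pi * x) = 0}"
    then have "sin (Arg a + pi * x) = 0" using a by (simp add: eq)
    then obtain i :: int where "Arg a + pi * x = of_int i * pi" by (auto simp: sin_zero_iff_int2)
    then have "x = i - Arg a / pi" by (simp add: field_simps)
    then show "x \<in> range (\<lambda>i::int. i - Arg a / pi)" by auto
  qed
  then have "countable {x. p * sin (pi * x) + q * cos (pi * x) = 0}"
    by (rule countable_subset) simp
  then show ?thesis
    by (intro AE_I'[OF countable_imp_null_set_lborel]) auto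
qed

text \<open>
  The Cayley transform \<open>u \<mapsto> (u + 1) / (u - 1)\<close> maps the unit disc into the left half-plane; here in the
  homogeneous form with \<open>u = p / q\<close>.
\<close>
lemma Re_cayley_nonpos:
  fixes p q :: complex
  assumes "norm p \<le> norm q"
  shows "Re ((p + q) / (p - q)) \<le> 0"
proof -
  have "Re ((p + q) / (p - q)) = ((norm p)\<^sup>2 - (norm q)\<^sup>2) / (norm (p - q))\<^sup>2"
    unfolding cmod_power2 Re_divide by (simp add: algebra_simps power2_eq_square)
  moreover have "(norm p)\<^sup>2 \<le> (norm q)\<^sup>2" using assms by (simp add: power_mono)
  ultimately show ?thesis by (simp add: divide_nonpos_nonneg)
qed

text \<open>
  On the unit circle the Cayley transform is purely imaginary and reads off a turned ratio.  The angle
  is doubled because the ratio does not change when the vector is turned by \<open>\<pi>\<close>; as a function of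
  \<open>cis (2 * \<theta>)\<close> it extends to the disc.
\<close>
lemma cayley_on_circle:
  fixes p q \<theta> :: real
  defines "a \<equiv> Complex p q"
  shows "(a * cis (2 * \<theta>) + cnj a) / (a * cis (2 * \<theta>) - cnj a) = - \<i> * of_real (turned_ratio \<theta> p q)"
    and "a * cis (2 * \<theta>) - cnj a = 2 * \<i> * cis \<theta> * of_real (p * sin \<theta> + q * cos \<theta>)"
proof -
  have c2: "cis (2 * \<theta>) = cis \<theta> * cis \<theta>" by (simp add: cis_mult)
  have c1: "cis \<theta> * cnj (a * cis \<theta>) = cnj a" by (simp add: cis_cnj cis_mult mult.left_commute)
  have c3: "cis \<theta> * (a * cis \<theta>) = a * cis (2 * \<theta>)" unfolding c2 by (simp only: mult_ac)
  have "a * cis (2 * \<theta>) - cnj a = cis \<theta> * (a * cis \<theta> - cnj (a * cis \<theta>))"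
    by (simp only: right_diff_distrib distrib_left c1 c3)
  also have "a * cis \<theta> - cnj (a * cis \<theta>) = 2 * \<i> * of_real (p * sin \<theta> + q * cos \<theta>)"
    by (simp add: complex_eq_iff a_def)
  finally show den: "a * cis (2 * \<theta>) - cnj a = 2 * \<i> * cis \<theta> * of_real (p * sin \<theta> + q * cos \<theta>)"
    by (simp add: mult_ac)
  have "a * cis (2 * \<theta>) + cnj a = cis \<theta> * (a * cis \<theta> + cnj (a * cis \<theta>))"
    by (simp only: right_diff_distrib distrib_left c1 c3)
  also have "a * cis \<theta> + cnj (a * cis \<theta>) = 2 * of_real (p * cos \<theta> - q * sin \<theta>)"
    by (simp add: complex_eq_iff a_def)
  finally have num: "a * cis (2 * \<theta>) + cnj a = cis \<theta> * (2 * of_real (p * cos \<theta> - q * sin \<theta>))" .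
  have cancel: "cis \<theta> * (2 * A) / (2 * \<i> * cis \<theta> * B) = - \<i> * (A / B)" for A B :: complex
    by (cases "B = 0") (simp_all add: field_simps)
  show "(a * cis (2 * \<theta>) + cnj a) / (a * cis (2 * \<theta>) - cnj a) = - \<i> * of_real (turned_ratio \<theta> p q)"
    unfolding num den turned_ratio_def of_real_divide cancel ..
qed

text \<open>
  With \<open>a j = p j + \<i> q j\<close>, the function \<open>F\<close> below extends
  \<open>exp (- \<i> s (\<Sum>j. w j * turned_ratio \<theta> (p j) (q j)))\<close> from the circle \<open>z = cis (2 * \<theta>)\<close> to the disc.
  It is bounded by \<open>1\<close> there because the exponent is a nonnegative combination of numbers in the left
  half-plane, so its mean over the circle is \<open>F 0\<close>.  At \<open>0\<close> every summand of the exponent is a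
  weight times \<open>-1\<close>, whatever the vectors \<open>(p j, q j)\<close> are, and the weights add up to \<open>1\<close>.
\<close>
lemma mean_turned_ratios_nonneg:
  fixes p q w :: "'i \<Rightarrow> real"
  assumes fin: "finite J" and pq: "\<And>j. j \<in> J \<Longrightarrow> p j \<noteq> 0 \<or> q j \<noteq> 0"
    and w: "\<And>j. j \<in> J \<Longrightarrow> 0 \<le> w j" "(\<Sum>j\<in>J. w j) = 1" and s: "0 \<le> s"
  shows "(\<integral>x. iexp (- s * (\<Sum>j\<in>J. w j * turned_ratio (pi * x) (p j) (q j))) \<partial>unit_uniform) = exp (- s)"
proof -
  define a where "a j = Complex (p j) (q j)" for j
  define K where "K z = (\<Sum>j\<in>J. of_real (w j) * ((a j * z + cnj (a j)) / (a j * z - cnj (a j))))" for z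
  define F where "F z = exp (of_real s * K z)" for z
  have a: "a j \<noteq> 0" if "j \<in> J" for j using pq[OF that] by (auto simp: a_def complex_eq_iff)
  have az: "norm (a j * z) < norm (cnj (a j))" if "j \<in> J" "z \<in> ball 0 1" for j z
    using a[OF that(1)] that(2) by (simp add: norm_mult)
  have F0: "F 0 = exp (- s)"
  proof -
    have "K 0 = (\<Sum>j\<in>J. - of_real (w j))"
      unfolding K_def by (intro sum.cong) (auto simp: a)
    also have "\<dots> = - 1" using w(2) by (simp add: sum_negf flip: of_real_sum)
    finally show ?thesis by (simp add: F_def flip: exp_of_real)
  qed
  have "(\<integral>x. iexp (- s * (\<Sum>j\<in>J. w j * turned_ratio (pi * x) (p j) (q j))) \<partial>unit_uniform) = F 0"
  proof (rule mean_value_boundary[where B=1])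
    show "F holomorphic_on ball 0 1"
      unfolding F_def K_def using az by (intro holomorphic_intros) fastforce
    show "norm (F z) \<le> 1" if z: "z \<in> ball 0 1" for z
    proof -
      have "Re (K z) = (\<Sum>j\<in>J. w j * Re ((a j * z + cnj (a j)) / (a j * z - cnj (a j))))"
        unfolding K_def Re_sum by (intro sum.cong refl) (simp only: Re_complex_of_real Im_complex_of_real times_complex.sel mult_zero_left diff_0_right)
      also have "\<dots> \<le> 0"
        using w az[OF _ z] by (intro sum_nonpos mult_nonneg_nonpos Re_cayley_nonpos) (auto simp: less_imp_le)
      finally show ?thesis using s by (simp add: F_def norm_exp_eq_Re mult_nonneg_nonpos)
    qed
    show "(\<lambda>x. iexp (- s * (\<Sum>j\<in>J. w j * turned_ratio (pi * x) (p j) (q j)))) \<in> borel_measurable borel"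
      unfolding turned_ratio_def by measurable
    have "AE x in lborel. \<forall>j\<in>J. p j * sin (pi * x) + q j * cos (pi * x) \<noteq> 0"
      using fin pq by (intro AE_finite_allI AE_turned_denominator_nonzero)
    then show "AE x in lborel. (F \<longlongrightarrow> iexp (- s * (\<Sum>j\<in>J. w j * turned_ratio (pi * x) (p j) (q j))))
        (at (cis (2 * pi * x)) within ball 0 1)"
    proof eventually_elim
      case (elim x)
      have ang: "2 * pi * x = 2 * (pi * x)" by simp
      have "a j * cis (2 * pi * x) - cnj (a j) \<noteq> 0" if "j \<in> J" for j
      proof -
        have "p j * sin (pi * x) + q j * cos (pi * x) \<noteq> 0" using elim that by blast
        then show ?thesis
          unfolding a_def ang cayley_on_circle(2) mult_eq_0_iff of_real_eq_0_iff by simp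
      qed
      then have "isCont F (cis (2 * pi * x))"
        unfolding F_def K_def by (intro continuous_intros) auto
      moreover have "F (cis (2 * pi * x)) = iexp (- s * (\<Sum>j\<in>J. w j * turned_ratio (pi * x) (p j) (q j)))"
        unfolding F_def K_def a_def ang cayley_on_circle(1)
        by (simp add: sum_distrib_left sum_negf mult_ac)
      ultimately show ?case
        using continuous_within_subset[of _ UNIV F "ball 0 1"] by (metis continuous_within subset_UNIV)
    qed
  qed
  then show ?thesis using F0 by simp
qed

text \<open>
  A convex combination of the ratios of any nonzero plane vectors, turned by a common uniform random
  angle, has the characteristic function \<open>exp (- \<bar>t\<bar>)\<close>.  The sign of \<open>t\<close> is handled by complex
  conjugation.
\<close>
lemma mean_turned_ratios:
  fixes p q w :: "'i \<Rightarrow> real"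
  assumes fin: "finite J" and pq: "\<And>j. j \<in> J \<Longrightarrow> p j \<noteq> 0 \<or> q j \<noteq> 0"
    and w: "\<And>j. j \<in> J \<Longrightarrow> 0 \<le> w j" "(\<Sum>j\<in>J. w j) = 1"
  shows "(\<integral>x. iexp (t * (\<Sum>j\<in>J. w j * turned_ratio (pi * x) (p j) (q j))) \<partial>unit_uniform) = exp (- \<bar>t\<bar>)"
proof -
  let ?z = "\<lambda>x. \<Sum>j\<in>J. w j * turned_ratio (pi * x) (p j) (q j)"
  note neg = mean_turned_ratios_nonneg[OF assms abs_ge_zero[of t]]
  show ?thesis
  proof (cases "t \<le> 0")
    case True
    then show ?thesis using neg by simp
  next
    case False
    have "(\<integral>x. iexp (t * ?z x) \<partial>unit_uniform) = (\<integral>x. cnj (iexp (- \<bar>t\<bar> * ?z x)) \<partial>unit_uniform)"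
      using False by (simp add: exp_cnj)
    also have "\<dots> = cnj (\<integral>x. iexp (- \<bar>t\<bar> * ?z x) \<partial>unit_uniform)" by (rule Bochner_Integration.integral_cnj)
    finally show ?thesis using neg by simp
  qed
qed

section \<open>The Cauchy law\<close>

text \<open>
  The substitution \<open>z = tan (\<pi> x - \<pi> / 2)\<close> turns the Cauchy law into the uniform law on \<open>{0..1}\<close>, and
  \<open>- tan (\<pi> x - \<pi> / 2)\<close> is the turned ratio of the vector \<open>(1, 0)\<close>.  The characteristic function is
  therefore the case of a single vector of \<open>mean_turned_ratios\<close>.
\<close>
lemma char_cauchy:
  "(\<integral>z. cauchy_density z *\<^sub>R iexp (t * z) \<partial>lborel) = exp (- \<bar>t\<bar>)"
proof -
  define f where "f z = cauchy_density z *\<^sub>R iexp (t * z)" for z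
  define g where "g x = tan (pi * x - pi / 2)" for x
  define g' where "g' x = pi * (1 + (g x)\<^sup>2)" for x
  have g: "g x = - turned_ratio (pi * x) 1 0" for x
    by (simp add: g_def turned_ratio_def tan_def sin_diff cos_diff)
  have pos: "0 < cos (pi * x - pi / 2)" if "0 < x" "x < 1" for x
    using that by (intro cos_gt_zero_pi) (auto simp: field_simps)
  have dens: "g' x * cauchy_density (g x) = 1" for x
    using sum_power2_gt_zero_iff[of 1 "g x"]
    by (simp add: g'_def cauchy_density_def)
  have gf: "g' x *\<^sub>R f (g x) = iexp (t * g x)" for x
    unfolding f_def by (simp only: scaleR_scaleR dens scaleR_one)
  have [measurable]: "g \<in> borel_measurable borel"
    unfolding g turned_ratio_def by measurable
  have int1: "set_integrable lborel (einterval 0 1) (\<lambda>x. g' x *\<^sub>R f (g x))"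
    unfolding gf set_integrable_def
    by (rule Bochner_Integration.integrable_bound[where f="indicator {0..1::real} :: real \<Rightarrow> real"])
      (auto simp: einterval_def split: split_indicator)
  have int2: "integrable lborel f"
  proof (rule Bochner_Integration.integrable_bound[where f="\<lambda>x. inverse (1 + x\<^sup>2) :: real"])
    show "integrable lborel (\<lambda>x. inverse (1 + x\<^sup>2) :: real)"
      using integrable_inverse_1_plus_square by (simp add: set_integrable_def)
    have "norm (f x) \<le> inverse (1 + x\<^sup>2)" for x
    proof -
      have "norm (f x) = inverse (1 + x\<^sup>2) / pi"
        by (simp add: f_def cauchy_density_def inverse_eq_divide mult.commute)
      also have "\<dots> \<le> inverse (1 + x\<^sup>2)"
        using pi_ge_two mult_left_mono[of 1 pi "inverse (1 + x\<^sup>2)"] by (intro mult_imp_div_pos_le) simp_all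
      finally show ?thesis .
    qed
    then show "AE x in lborel. norm (f x) \<le> norm (inverse (1 + x\<^sup>2) :: real)"
      by (simp add: abs_of_nonneg)
  qed (simp add: f_def[abs_def] cauchy_density_def[abs_def])
  have "(LBINT x=-\<infinity>..\<infinity>. f x) = (LBINT x=0..1. g' x *\<^sub>R f (g x))"
  proof (rule interval_integral_substitution_integrable[where g=g and g'=g'])
    show "DERIV g x :> g' x" if "0 < ereal x" "ereal x < 1" for x
      unfolding g_def g'_def using pos[of x] that tan_sec[of "pi * x - pi / 2"]
      by (auto intro!: derivative_eq_intros simp: power_inverse)
    show "isCont f (g x)" if "0 < ereal x" "ereal x < 1" for x
      unfolding f_def cauchy_density_def
      by (intro continuous_intros) (auto simp: add_nonneg_eq_0_iff)
    show "isCont g' x" if "0 < ereal x" "ereal x < 1" for x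
      unfolding g'_def g_def using pos[of x] that by (intro continuous_intros) auto
    show "0 \<le> g' x" for x by (simp add: g'_def)
    have 1: "filterlim (\<lambda>x. pi * x - pi / 2) (at_right (- (pi / 2))) (at_right 0)"
      by real_asymp
    have 2: "filterlim (\<lambda>x. pi * x - pi / 2) (at_left (pi / 2)) (at_left 1)"
      by real_asymp
    show "((ereal \<circ> g \<circ> real_of_ereal) \<longlongrightarrow> -\<infinity>) (at_right 0)"
      using filterlim_compose[OF filterlim_tan_at_right 1]
      unfolding zero_ereal_def ereal_tendsto_simps g_def .
    show "((ereal \<circ> g \<circ> real_of_ereal) \<longlongrightarrow> \<infinity>) (at_left 1)"
      using filterlim_compose[OF filterlim_tan_at_left 2]
      unfolding one_ereal_def ereal_tendsto_simps g_def .
  qed (use int1 int2 in \<open>auto simp: set_integrable_def\<close>)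
  also have "\<dots> = (\<integral>x. indicator {0<..<1} x *\<^sub>R iexp (t * g x) \<partial>lborel)"
    by (simp add: gf interval_lebesgue_integral_def set_lebesgue_integral_def zero_ereal_def one_ereal_def einterval_eq)
  also have "\<dots> = (\<integral>x. indicator {0..1} x *\<^sub>R iexp (t * g x) \<partial>lborel)"
  proof (rule integral_cong_AE)
    have "AE x in lborel. x \<noteq> (0::real)" "AE x in lborel. x \<noteq> (1::real)" by (rule AE_lborel_singleton)+
    then show "AE x in lborel. indicator {0<..<1} x *\<^sub>R iexp (t * g x) = indicator {0..1} x *\<^sub>R iexp (t * g x)"
      by eventually_elim (auto split: split_indicator)
  qed measurable
  also have "\<dots> = (\<integral>x. iexp (t * g x) \<partial>unit_uniform)"
    by (rule integral_unit_uniform[symmetric]) measurable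
  also have "\<dots> = exp (- \<bar>t\<bar>)"
    using mean_turned_ratios[of "{()}" "\<lambda>_. 1" "\<lambda>_. 0" "\<lambda>_. 1" "- t"] by (simp add: g)
  finally show ?thesis
    by (simp add: f_def interval_lebesgue_integral_def set_lebesgue_integral_def)
qed

lemma real_distribution_cauchy: "real_distribution (density lborel (\<lambda>z. ennreal (cauchy_density z)))"
  unfolding real_distribution_def real_distribution_axioms_def
proof (intro conjI prob_spaceI)
  have [measurable]: "cauchy_density \<in> borel_measurable borel"
    unfolding cauchy_density_def[abs_def] by measurable
  have nn: "0 \<le> cauchy_density z" for z by (simp add: cauchy_density_def)
  have "integrable lborel (\<lambda>x. inverse (1 + x\<^sup>2) / pi :: real)"
    using integrable_inverse_1_plus_square by (simp add: set_integrable_def)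
  then have int: "integrable lborel cauchy_density"
    by (simp add: cauchy_density_def[abs_def] field_simps)
  \<comment> \<open>The total mass is the Fourier transform at \<open>0\<close>.\<close>
  have "(\<integral>z. cauchy_density z \<partial>lborel) = 1"
  proof -
    have "complex_of_real (\<integral>z. cauchy_density z \<partial>lborel) = 1"
      using char_cauchy[of 0] by (simp add: scaleR_conv_of_real)
    then show ?thesis by (simp only: of_real_eq_1_iff)
  qed
  then show "emeasure (density lborel (\<lambda>z. ennreal (cauchy_density z))) (space (density lborel (\<lambda>z. ennreal (cauchy_density z)))) = 1"
    using int nn by (simp add: emeasure_density nn_integral_eq_integral)
qed auto

section \<open>Linear functionals of centered Gaussian vectors\<close>

lemma normal_law_mean:
  assumes "0 \<le> \<sigma>"
  shows "integrable (normal_law \<mu> \<sigma>) (\<lambda>x. x)" "(\<integral>x. x \<partial>normal_law \<mu> \<sigma>) = \<mu>"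
proof -
  have "integrable (normal_law \<mu> \<sigma>) (\<lambda>x. x) \<and> (\<integral>x. x \<partial>normal_law \<mu> \<sigma>) = \<mu>"
  proof (cases "\<sigma> = 0")
    case True
    have "integrable (return borel \<mu>) (\<lambda>x. x::real)"
      by (rule finite_measure.integrable_const_bound[where B="\<bar>\<mu>\<bar>"])
        (auto simp: AE_return prob_space_return prob_space.finite_measure)
    moreover have "(\<integral>x. x \<partial>return borel \<mu>) = \<mu>" by (rule integral_return) auto
    ultimately show ?thesis unfolding normal_law_def if_P[OF True] ..
  next
    case False
    then have s: "0 < \<sigma>" using assms by simp
    let ?N = "density lborel (\<lambda>x. ennreal (normal_density \<mu> \<sigma> x))"
    have "integrable ?N (\<lambda>x. x)"
      by (subst integrable_density)
        (auto intro: normal_density_nonneg simp: integrable_normal_moment_nz_1[OF s])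
    moreover have "(\<integral>x. x \<partial>?N) = \<mu>"
      by (subst integral_density)
        (auto intro: normal_density_nonneg simp: integral_normal_moment_nz_1[OF s])
    ultimately show ?thesis unfolding normal_law_def if_not_P[OF False] ..
  qed
  then show "integrable (normal_law \<mu> \<sigma>) (\<lambda>x. x)" "(\<integral>x. x \<partial>normal_law \<mu> \<sigma>) = \<mu>"
    by blast+
qed

lemma normal_law_second_moment: 
  assumes "0 \<le> \<sigma>"
  shows "integrable (normal_law 0 \<sigma>) (\<lambda>x. x\<^sup>2)" "(\<integral>x. x\<^sup>2 \<partial>normal_law 0 \<sigma>) = \<sigma>\<^sup>2"
proof -
  have "has_bochner_integral (normal_law 0 \<sigma>) (\<lambda>x. x\<^sup>2) (\<sigma>\<^sup>2)"
  proof (cases "\<sigma> = 0")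
    case True
    have "integrable (return borel 0) (\<lambda>x. x\<^sup>2::real)"
      by (rule finite_measure.integrable_const_bound[where B=0])
        (auto simp: AE_return prob_space_return prob_space.finite_measure)
    then show ?thesis using True by (simp add: normal_law_def has_bochner_integral_iff integral_return)
  next
    case False
    then have "0 < \<sigma>" using assms by simp
    then show ?thesis using False integrable_normal_moment[of \<sigma> 0 2] integral_normal_moment_even[of \<sigma> 0 1]
      by (simp add: normal_law_def has_bochner_integral_iff integrable_density integral_density
          normal_density_nonneg)
  qed
  then show "integrable (normal_law 0 \<sigma>) (\<lambda>x. x\<^sup>2)" "(\<integral>x. x\<^sup>2 \<partial>normal_law 0 \<sigma>) = \<sigma>\<^sup>2"
    by (simp_all add: has_bochner_integral_iff)
qed

lemma char_normal_law:
  assumes "0 \<le> \<sigma>"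
  shows "char (normal_law 0 \<sigma>) t = exp (- (\<sigma>\<^sup>2 * t\<^sup>2) / 2)"
proof (cases "\<sigma> = 0")
  case True
  then show ?thesis by (simp add: normal_law_def char_def integral_return)
next
  case False
  then have s: "0 < \<sigma>" using assms by simp
  define P where "P = density lborel (\<lambda>x. ennreal (normal_density 0 \<sigma> x))"
  interpret P: prob_space P unfolding P_def by (rule prob_space_normal_density[OF s])
  have [measurable_cong]: "sets P = sets borel" by (simp add: P_def)
  have "distr P lborel (\<lambda>x. x) = P" by (rule distr_id2) (simp add: P_def)
  then have "distributed P lborel (\<lambda>x. x) (normal_density 0 \<sigma>)"
    unfolding distributed_def by (simp add: P_def)
  then have "distributed P lborel (\<lambda>x. (x - 0) / \<sigma>) std_normal_density"
    by (rule P.normal_standard_normal_convert[OF s, THEN iffD1])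
  then have std: "distr P lborel (\<lambda>x. x / \<sigma>) = std_normal_distribution"
    by (simp add: distributed_def)
  have "char P t = (\<integral>x. iexp ((t * \<sigma>) * (x / \<sigma>)) \<partial>P)"
    unfolding char_def using s by simp
  also have "\<dots> = (\<integral>y. iexp ((t * \<sigma>) * y) \<partial>distr P lborel (\<lambda>x. x / \<sigma>))"
    by (rule integral_distr[symmetric]) auto
  also have "\<dots> = char std_normal_distribution (t * \<sigma>)"
    by (simp add: std char_def)
  finally show ?thesis using False
    by (simp add: normal_law_def P_def char_std_normal_distribution power_mult_distrib mult.commute)
qed

text \<open>
  The mean and the standard deviation that are only asserted to exist in \<^const>\<open>gaussian_law\<close> are
  identified by computing the first two moments of \<open>t \<bullet> x\<close> from those of the coordinates.
\<close>
lemma centered_gaussian_linear_functional: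
  assumes N: "centered_gaussian S N"
  shows "0 \<le> t \<bullet> (S *v t)" "distr N borel (\<lambda>x. t \<bullet> x) = normal_law 0 (sqrt (t \<bullet> (S *v t)))"
proof -
  have sN [measurable_cong]: "sets N = sets borel"
    and lin: "\<And>t. \<exists>\<mu> \<sigma>. 0 \<le> \<sigma> \<and> distr N borel (\<lambda>x. t \<bullet> x) = normal_law \<mu> \<sigma>"
    and mean: "\<And>i. (\<integral>x. x $ i \<partial>N) = 0"
    and cov: "\<And>i j. (\<integral>x. x $ i * x $ j \<partial>N) = S $ i $ j"
    using N unfolding centered_gaussian_def gaussian_law_def by auto
  have comp [measurable]: "(\<lambda>x. x $ i) \<in> borel_measurable N" for i
    by (simp add: measurable_cong_sets[OF sN refl])
  have int: "integrable N (\<lambda>x. x $ i) \<and> integrable N (\<lambda>x. (x $ i)\<^sup>2)" for i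
  proof -
    obtain \<mu> \<sigma> where *: "0 \<le> \<sigma>" "distr N borel (\<lambda>x. x $ i) = normal_law \<mu> \<sigma>"
      using lin[of "axis i 1"] by (auto simp: inner_axis' )
    then have int: "integrable N (\<lambda>x. x $ i)" and "\<mu> = 0"
      using normal_law_mean[OF *(1), of \<mu>] mean[of i]
      by (simp_all flip: *(2) add: integrable_distr_eq integral_distr)
    moreover have "integrable (distr N borel (\<lambda>x. x $ i)) (\<lambda>x. x\<^sup>2)"
      using normal_law_second_moment(1)[OF *(1)] \<open>\<mu> = 0\<close> *(2) by simp
    then have "integrable N (\<lambda>x. (x $ i)\<^sup>2)" by (subst (asm) integrable_distr_eq) auto
    ultimately show ?thesis by blast
  qed
  have int2: "integrable N (\<lambda>x. x $ i * x $ j)" for i j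
  proof (rule Bochner_Integration.integrable_bound)
    show "integrable N (\<lambda>x. (x $ i)\<^sup>2 + (x $ j)\<^sup>2)" using int by simp
    have "\<bar>a * b\<bar> \<le> a\<^sup>2 + b\<^sup>2" for a b :: real
      using sum_squares_bound[of "\<bar>a\<bar>" "\<bar>b\<bar>"] mult_nonneg_nonneg[OF abs_ge_zero[of a] abs_ge_zero[of b]]
      unfolding abs_mult power2_abs by linarith
    then show "AE x in N. norm (x $ i * x $ j) \<le> norm ((x $ i)\<^sup>2 + (x $ j)\<^sup>2)" by simp
  qed simp
  obtain \<mu> \<sigma> where *: "0 \<le> \<sigma>" "distr N borel (\<lambda>x. t \<bullet> x) = normal_law \<mu> \<sigma>"
    using lin by blast
  have tx: "t \<bullet> x = (\<Sum>i\<in>UNIV. t $ i * x $ i)" for x by (simp add: inner_vec_def)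
  have [measurable]: "(\<lambda>x. t \<bullet> x) \<in> borel_measurable N" by measurable
  have "\<mu> = (\<integral>x. t \<bullet> x \<partial>N)"
    using normal_law_mean(2)[OF *(1), of \<mu>] by (simp flip: *(2) add: integral_distr)
  also have "\<dots> = 0" unfolding tx using int mean by simp
  finally have mu: "\<mu> = 0" .
  have "\<sigma>\<^sup>2 = (\<integral>x. (t \<bullet> x)\<^sup>2 \<partial>N)"
  proof -
    have "(\<integral>x. (t \<bullet> x)\<^sup>2 \<partial>N) = (\<integral>y. y\<^sup>2 \<partial>distr N borel (\<lambda>x. t \<bullet> x))"
      by (subst integral_distr) auto
    then show ?thesis unfolding * mu normal_law_second_moment(2)[OF *(1)] ..
  qed
  also have "\<dots> = (\<integral>x. (\<Sum>i\<in>UNIV. \<Sum>j\<in>UNIV. (t $ i * t $ j) * (x $ i * x $ j)) \<partial>N)"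
    unfolding tx power2_eq_square sum_product by (simp add: mult_ac)
  also have "\<dots> = (\<Sum>i\<in>UNIV. \<Sum>j\<in>UNIV. (t $ i * t $ j) * S $ i $ j)"
    using int2 cov by simp
  also have "\<dots> = t \<bullet> (S *v t)"
    by (simp add: inner_vec_def matrix_vector_mult_def sum_distrib_left mult_ac)
  finally have s: "\<sigma>\<^sup>2 = t \<bullet> (S *v t)" .
  show "0 \<le> t \<bullet> (S *v t)" by (simp flip: s)
  show "distr N borel (\<lambda>x. t \<bullet> x) = normal_law 0 (sqrt (t \<bullet> (S *v t)))"
    using * mu by (simp flip: s)
qed

text \<open>
  The zero functional has the law \<open>N(0, 0)\<close>, a point mass, so the total mass is \<open>1\<close>.
\<close>
lemma centered_gaussian_prob_space: 
  assumes "centered_gaussian S N"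
  shows "prob_space N"
proof -
  have [measurable_cong]: "sets N = sets borel" using assms by (simp add: centered_gaussian_def gaussian_law_def)
  have sp: "space N = UNIV" using sets_eq_imp_space_eq[of N borel] \<open>sets N = _\<close> by simp
  have "distr N borel (\<lambda>x. 0 \<bullet> x) = return borel 0"
    using centered_gaussian_linear_functional(2)[OF assms, of 0] by (simp add: normal_law_def)
  then have "emeasure (distr N borel (\<lambda>x. 0 \<bullet> x)) UNIV = 1" by simp
  then show ?thesis by (intro prob_spaceI) (simp add: emeasure_distr sp)
qed

lemma char_centered_gaussian:
  assumes N: "centered_gaussian S N"
  shows "(\<integral>x. iexp (t \<bullet> x) \<partial>N) = exp (- (t \<bullet> (S *v t)) / 2)"
proof -
  have [measurable_cong]: "sets N = sets borel" using N by (simp add: centered_gaussian_def gaussian_law_def)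
  have "(\<integral>x. iexp (t \<bullet> x) \<partial>N) = char (distr N borel (\<lambda>x. t \<bullet> x)) 1"
    unfolding char_def by (subst integral_distr) auto
  then show ?thesis
    using centered_gaussian_linear_functional[OF N, of t] by (simp add: char_normal_law)
qed

lemma centered_gaussian_AE_nonzero:
  assumes N: "centered_gaussian S N" and pos: "0 < S $ j $ j"
  shows "AE x in N. x $ j \<noteq> 0"
proof -
  have [measurable_cong]: "sets N = sets borel" using N by (simp add: centered_gaussian_def gaussian_law_def)
  have v: "(S *v axis j 1) $ j = S $ j $ j"
    by (simp add: matrix_vector_mult_basis column_def)
  have D: "distr N borel (\<lambda>x. x $ j) = normal_law 0 (sqrt (S $ j $ j))"
    using centered_gaussian_linear_functional(2)[OF N, of "axis j 1"] by (simp add: v inner_axis')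
  have "AE x in normal_law 0 (sqrt (S $ j $ j)). x \<noteq> 0"
  proof -
    have "sqrt (S $ j $ j) \<noteq> 0" using pos by simp
    then show ?thesis
      using AE_lborel_singleton[of "0::real"] unfolding normal_law_def
      by (auto simp: AE_density elim!: eventually_mono)
  qed
  then have "AE x in distr N borel (\<lambda>x. x $ j). x \<noteq> 0" unfolding D .
  then show ?thesis by (subst (asm) AE_distr_iff) auto
qed

section \<open>Rotation invariance and weighted ratios\<close>

text \<open>
  The rotation by \<open>\<theta>\<close> of each of the plane vectors \<open>(x\<^sub>j, y\<^sub>j)\<close> simultaneously.
\<close>
definition turn :: "real \<Rightarrow> (real ^ 'm) \<times> (real ^ 'm) \<Rightarrow> (real ^ 'm) \<times> (real ^ 'm)" where
  "turn \<theta> z = (cos \<theta> *\<^sub>R fst z - sin \<theta> *\<^sub>R snd z, sin \<theta> *\<^sub>R fst z + cos \<theta> *\<^sub>R snd z)"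

text \<open>
  The exponent of the characteristic function of the pair is \<open>Q s + Q t\<close> for a quadratic form \<open>Q\<close>, and this sum does not
  change when the pair \<open>(s, t)\<close> is rotated.
\<close>
lemma distr_turn_gaussian_pair:
  fixes S :: "real ^ 'm ^ 'm"
  assumes N1: "centered_gaussian S N1" and N2: "centered_gaussian S N2"
  shows "distr (N1 \<Otimes>\<^sub>M N2) borel (turn \<theta>) = N1 \<Otimes>\<^sub>M N2"
proof -
  interpret N1: prob_space N1 by (rule centered_gaussian_prob_space[OF N1])
  interpret N2: prob_space N2 by (rule centered_gaussian_prob_space[OF N2])
  interpret P: pair_prob_space N1 N2 ..
  have s1 [measurable_cong]: "sets N1 = sets borel" and s2 [measurable_cong]: "sets N2 = sets borel"
    using N1 N2 by (simp_all add: centered_gaussian_def gaussian_law_def)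
  have sP: "sets (N1 \<Otimes>\<^sub>M N2) = sets borel"
    unfolding sets_pair_measure_cong[OF s1 s2] borel_prod ..
  note [measurable_cong] = sP
  define Q where "Q t = t \<bullet> (S *v t)" for t
  have chP: "(\<integral>z. iexp ((s, t) \<bullet> z) \<partial>(N1 \<Otimes>\<^sub>M N2)) = exp (- (Q s + Q t) / 2)" for s t
  proof -
    have "(\<integral>z. iexp ((s, t) \<bullet> z) \<partial>(N1 \<Otimes>\<^sub>M N2)) = (\<integral>x. \<integral>y. iexp ((s, t) \<bullet> (x, y)) \<partial>N2 \<partial>N1)"
      by (intro P.integral_fst'[symmetric] P.integrable_const_bound[where B=1]) auto
    also have "\<dots> = (\<integral>x. iexp (s \<bullet> x) * (\<integral>y. iexp (t \<bullet> y) \<partial>N2) \<partial>N1)"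
      by (simp add: distrib_left exp_add)
    also have "\<dots> = exp (- (Q s + Q t) / 2)"
      using char_centered_gaussian[OF N1, of s] char_centered_gaussian[OF N2, of t]
      by (simp add: Q_def exp_add[symmetric] add_divide_distrib flip: of_real_mult)
    finally show ?thesis .
  qed
  have Q_turn: "Q (c *\<^sub>R s + d *\<^sub>R t) + Q (c *\<^sub>R t - d *\<^sub>R s) = (c\<^sup>2 + d\<^sup>2) * (Q s + Q t)" for c d s t
    unfolding Q_def
    by (simp add: matrix_vector_right_distrib matrix_vector_mult_diff_distrib matrix_vector_mult_scaleR
        inner_simps power2_eq_square algebra_simps)
  have mt [measurable]: "turn \<theta> \<in> borel_measurable borel"
    unfolding turn_def[abs_def] by (intro borel_measurable_continuous_onI continuous_intros)
  show ?thesis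
  proof (rule euclidean_measure_eq_if_char_eq)
    show "finite_measure (distr (N1 \<Otimes>\<^sub>M N2) borel (turn \<theta>))"
      by (rule P.finite_measure_distr) simp
    fix v :: "(real ^ 'm) \<times> (real ^ 'm)"
    obtain s t where v: "v = (s, t)" by (cases v)
    let ?c = "cos \<theta>" and ?d = "sin \<theta>"
    have rot: "v \<bullet> turn \<theta> z = (?c *\<^sub>R s + ?d *\<^sub>R t, ?c *\<^sub>R t - ?d *\<^sub>R s) \<bullet> z" for z
      by (simp add: v turn_def inner_prod_def inner_add_left inner_add_right inner_diff_left inner_diff_right)
    have "(\<integral>z. iexp (v \<bullet> z) \<partial>distr (N1 \<Otimes>\<^sub>M N2) borel (turn \<theta>)) = (\<integral>z. iexp (v \<bullet> turn \<theta> z) \<partial>(N1 \<Otimes>\<^sub>M N2))"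
      by (rule integral_distr) auto
    also have "\<dots> = (\<integral>z. iexp ((?c *\<^sub>R s + ?d *\<^sub>R t, ?c *\<^sub>R t - ?d *\<^sub>R s) \<bullet> z) \<partial>(N1 \<Otimes>\<^sub>M N2))"
      unfolding rot ..
    also have "\<dots> = exp (- (Q (?c *\<^sub>R s + ?d *\<^sub>R t) + Q (?c *\<^sub>R t - ?d *\<^sub>R s)) / 2)"
      by (rule chP)
    also have "Q (?c *\<^sub>R s + ?d *\<^sub>R t) + Q (?c *\<^sub>R t - ?d *\<^sub>R s) = (?c\<^sup>2 + ?d\<^sup>2) * (Q s + Q t)"
      by (rule Q_turn)
    also have "exp (- ((?c\<^sup>2 + ?d\<^sup>2) * (Q s + Q t)) / 2) = exp (- (Q s + Q t) / 2)" by simp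
    finally show "(\<integral>z. iexp (v \<bullet> z) \<partial>distr (N1 \<Otimes>\<^sub>M N2) borel (turn \<theta>)) = (\<integral>z. iexp (v \<bullet> z) \<partial>(N1 \<Otimes>\<^sub>M N2))"
      by (simp only: v chP)
  qed (use sP P.finite_measure_axioms in auto)
qed

text \<open>
  Averaging the rotation invariance over all angles replaces each ratio \<open>x\<^sub>j / y\<^sub>j\<close> by a turned ratio
  with a uniform random angle.  The average over the angle is the same constant for almost every pair
  \<open>(x, y)\<close>, so it is also the expectation.  The positive variances ensure that almost surely none of
  the plane vectors \<open>(x\<^sub>j, y\<^sub>j)\<close> vanishes, as \<open>mean_turned_ratios\<close> demands.
\<close>
lemma char_ratios_fixed_weights:
  fixes w :: "real ^ 'm"
  assumes N1: "centered_gaussian S N1" and N2: "centered_gaussian S N2"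
    and pos: "\<And>j. 0 < S $ j $ j"
    and w: "\<And>j. 0 \<le> w $ j" "(\<Sum>j\<in>UNIV. w $ j) = 1"
  shows "(\<integral>z. iexp (t * (\<Sum>j\<in>UNIV. w $ j * (fst z $ j / snd z $ j))) \<partial>(N1 \<Otimes>\<^sub>M N2)) = exp (- \<bar>t\<bar>)"
proof -
  interpret N1: prob_space N1 by (rule centered_gaussian_prob_space[OF N1])
  interpret N2: prob_space N2 by (rule centered_gaussian_prob_space[OF N2])
  interpret P: pair_prob_space N1 N2 ..
  interpret U: prob_space unit_uniform by (rule prob_space_unit_uniform)
  interpret UP: pair_prob_space unit_uniform "N1 \<Otimes>\<^sub>M N2" ..
  let ?P = "N1 \<Otimes>\<^sub>M N2"
  have s1 [measurable_cong]: "sets N1 = sets borel" and s2 [measurable_cong]: "sets N2 = sets borel"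
    using N1 N2 by (simp_all add: centered_gaussian_def gaussian_law_def)
  have comp [measurable]: "(\<lambda>x::real^'m. x $ j) \<in> borel_measurable borel" for j by simp
  have mt [measurable]: "turn \<theta> \<in> borel_measurable (borel \<Otimes>\<^sub>M borel)" for \<theta>
    unfolding turn_def[abs_def] borel_prod by (intro borel_measurable_continuous_onI continuous_intros)
  define h where "h z = iexp (t * (\<Sum>j\<in>UNIV. w $ j * (fst z $ j / snd z $ j)))" for z :: "(real ^ 'm) \<times> (real ^ 'm)"
  have hm: "h \<in> borel_measurable (borel \<Otimes>\<^sub>M borel)"
    unfolding h_def by measurable
  then have [measurable]: "h \<in> borel_measurable borel" by (simp add: borel_prod)
  define k where "k u z = iexp (t * (\<Sum>j\<in>UNIV. w $ j * turned_ratio (pi * u) (fst z $ j) (snd z $ j)))"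
    for u and z :: "(real ^ 'm) \<times> (real ^ 'm)"
  have hk: "h (turn (pi * u) z) = k u z" for u z
    by (simp add: h_def k_def turn_def turned_ratio_def mult_ac)
  have km [measurable]: "(\<lambda>(u, z). k u z) \<in> borel_measurable (unit_uniform \<Otimes>\<^sub>M ?P)"
    unfolding k_def turned_ratio_def by measurable
  have "(\<integral>z. k u z \<partial>?P) = (\<integral>z. h z \<partial>?P)" for u
  proof -
    have "(\<integral>z. k u z \<partial>?P) = (\<integral>z. h z \<partial>distr ?P borel (turn (pi * u)))"
      unfolding hk[symmetric] by (rule integral_distr[symmetric]) measurable
    then show ?thesis by (simp only: distr_turn_gaussian_pair[OF N1 N2])
  qed
  then have "(\<integral>z. h z \<partial>?P) = (\<integral>u. \<integral>z. k u z \<partial>?P \<partial>unit_uniform)"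
    using U.prob_space by simp
  also have "\<dots> = (\<integral>z. \<integral>u. k u z \<partial>unit_uniform \<partial>?P)"
    by (intro UP.Fubini_integral[symmetric] UP.integrable_const_bound[where B=1] km)
      (auto simp: k_def)
  also have "\<dots> = (\<integral>z. complex_of_real (exp (- \<bar>t\<bar>)) \<partial>?P)"
  proof (rule integral_cong_AE)
    have "AE z in ?P. \<forall>j. snd z $ j \<noteq> 0"
    proof -
      have *: "AE y in N2. \<forall>j. y $ j \<noteq> 0"
        unfolding AE_all_countable using centered_gaussian_AE_nonzero[OF N2 pos] by blast
      show ?thesis
        by (intro P.AE_pair_measure) (use * in auto)
    qed
    then show "AE z in ?P. (\<integral>u. k u z \<partial>unit_uniform) = complex_of_real (exp (- \<bar>t\<bar>))"
    proof eventually_elim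
      case (elim z)
      then show ?case unfolding k_def by (intro mean_turned_ratios) (auto simp: w)
    qed
    show "(\<lambda>z. \<integral>u. k u z \<partial>unit_uniform) \<in> borel_measurable ?P"
      using km by measurable
  qed simp
  also have "\<dots> = exp (- \<bar>t\<bar>)" using P.prob_space by simp
  finally show ?thesis unfolding h_def .
qed

lemma indep_rv_joint_law:
  assumes "prob_space M" and ind: "indep_rv M S U T V"
  shows "distr M S U \<Otimes>\<^sub>M distr M T V = distr M (S \<Otimes>\<^sub>M T) (\<lambda>\<omega>. (U \<omega>, V \<omega>))"
proof -
  interpret prob_space M by fact
  have [measurable]: "U \<in> measurable M S" "V \<in> measurable M T"
    and gen: "indep_set {U -` A \<inter> space M | A. A \<in> sets S} {V -` B \<inter> space M | B. B \<in> sets T}"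
    using ind by (auto simp: indep_rv_def)
  show ?thesis
  proof (rule pair_measure_eqI)
    fix A B assume "A \<in> sets (distr M S U)" "B \<in> sets (distr M T V)"
    then have [measurable]: "A \<in> sets S" "B \<in> sets T" by auto
    have "prob ((U -` A \<inter> space M) \<inter> (V -` B \<inter> space M)) = prob (U -` A \<inter> space M) * prob (V -` B \<inter> space M)"
      using \<open>A \<in> sets S\<close> \<open>B \<in> sets T\<close> by (intro indep_setD[OF gen]) auto
    moreover have "(\<lambda>\<omega>. (U \<omega>, V \<omega>)) -` (A \<times> B) \<inter> space M = (U -` A \<inter> space M) \<inter> (V -` B \<inter> space M)"
      by auto
    ultimately show "emeasure (distr M S U) A * emeasure (distr M T V) B = emeasure (distr M (S \<Otimes>\<^sub>M T) (\<lambda>\<omega>. (U \<omega>, V \<omega>))) (A \<times> B)"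
      by (simp add: emeasure_distr emeasure_eq_measure ennreal_mult)
  qed (auto intro!: prob_space_imp_sigma_finite prob_space_distr)
qed

text \<open>
  Conditionally on the weights the characteristic function is \<open>exp (- \<bar>t\<bar>)\<close>, which does not depend on
  them; hence it is also the unconditional one.
\<close>
theorem theorem1p1:
  fixes M :: "'a measure"
    and S :: "real ^ 'm ^ 'm"
    and X Y w :: "'a \<Rightarrow> real ^ 'm"
  assumes "prob_space M"
    and "positive_semidefinite S"
    and "\<And>j. 0 < S $ j $ j"
    and "X \<in> borel_measurable M" and "Y \<in> borel_measurable M" and "w \<in> borel_measurable M"
    and "centered_gaussian S (distr M borel X)"
    and "centered_gaussian S (distr M borel Y)"
    and "prob_space.indep_var M borel X borel Y"
    and "indep_rv M borel w borel (\<lambda>\<omega>. (X \<omega>, Y \<omega>))"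
    and "AE \<omega> in M. (\<forall>j. 0 \<le> w \<omega> $ j) \<and> (\<Sum>j\<in>UNIV. w \<omega> $ j) = 1"
  shows "distributed M lborel (\<lambda>\<omega>. \<Sum>j\<in>UNIV. w \<omega> $ j * (X \<omega> $ j / Y \<omega> $ j)) cauchy_density"
proof -
  interpret prob_space M by fact
  note [measurable] = assms(4-6)
  have [measurable]: "(\<lambda>x::real^'m. x $ j) \<in> borel_measurable borel" for j by simp
  define Z where "Z \<omega> = (\<Sum>j\<in>UNIV. w \<omega> $ j * (X \<omega> $ j / Y \<omega> $ j))" for \<omega>
  have Z [measurable]: "Z \<in> borel_measurable M" unfolding Z_def by measurable
  define W where "W = distr M borel w"
  define P where "P = distr M borel (\<lambda>\<omega>. (X \<omega>, Y \<omega>))"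
  have P: "P = distr M borel X \<Otimes>\<^sub>M distr M borel Y"
    using assms(9) unfolding indep_var_distribution_eq P_def by (simp add: borel_prod)
  have [measurable]: "(\<lambda>\<omega>. (X \<omega>, Y \<omega>)) \<in> borel_measurable M"
    using assms(10) by (simp add: indep_rv_def)
  interpret W: prob_space W unfolding W_def by (rule prob_space_distr) simp
  interpret P: prob_space P unfolding P_def by (rule prob_space_distr) simp
  interpret WP: pair_prob_space W P ..
  have joint: "W \<Otimes>\<^sub>M P = distr M (borel \<Otimes>\<^sub>M borel) (\<lambda>\<omega>. (w \<omega>, (X \<omega>, Y \<omega>)))"
    unfolding W_def P_def by (rule indep_rv_joint_law) fact+
  define k where "k t v z = iexp (t * (\<Sum>j\<in>UNIV. v $ j * (fst z $ j / snd z $ j)))"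
    for t and v :: "real ^ 'm" and z :: "(real ^ 'm) \<times> (real ^ 'm)"
  have k_norm: "norm (k t v z) = 1" for t v z by (simp add: k_def)
  have "(\<lambda>(v, z). k t v z) \<in> borel_measurable (borel \<Otimes>\<^sub>M (borel \<Otimes>\<^sub>M borel))" for t
    unfolding k_def by measurable
  then have km [measurable]: "(\<lambda>(v, z). k t v z) \<in> borel_measurable (borel \<Otimes>\<^sub>M borel)" for t
    by (simp add: borel_prod)
  have sWP [measurable_cong]: "sets W = sets borel" "sets P = sets borel" by (simp_all add: W_def P_def)
  have "char (distr M borel Z) t = char (density lborel (\<lambda>z. ennreal (cauchy_density z))) t" for t
  proof -
    have "char (distr M borel Z) t = (\<integral>\<omega>. k t (w \<omega>) (X \<omega>, Y \<omega>) \<partial>M)"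
      unfolding char_def by (subst integral_distr) (auto simp: k_def Z_def)
    also have "\<dots> = (\<integral>x. (\<lambda>(v, z). k t v z) x \<partial>(W \<Otimes>\<^sub>M P))"
      unfolding joint by (subst integral_distr) auto
    also have "\<dots> = (\<integral>v. \<integral>z. k t v z \<partial>P \<partial>W)"
    proof (subst WP.integral_fst'[symmetric])
      show "integrable (W \<Otimes>\<^sub>M P) (\<lambda>(v, z). k t v z)"
        by (intro WP.integrable_const_bound[where B=1]) (auto simp: k_norm)
    qed simp
    also have "\<dots> = (\<integral>v. complex_of_real (exp (- \<bar>t\<bar>)) \<partial>W)"
    proof (rule integral_cong_AE)
      have "AE v in W. (\<forall>j. 0 \<le> v $ j) \<and> (\<Sum>j\<in>UNIV. v $ j) = 1"
        unfolding W_def by (subst AE_distr_iff) (use assms(11) in auto)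
      then show "AE v in W. (\<integral>z. k t v z \<partial>P) = complex_of_real (exp (- \<bar>t\<bar>))"
        by eventually_elim (unfold k_def P, intro char_ratios_fixed_weights[OF assms(7,8,3)], auto)
      show "(\<lambda>v. \<integral>z. k t v z \<partial>P) \<in> borel_measurable W"
        by measurable
    qed simp
    also have "\<dots> = exp (- \<bar>t\<bar>)" using W.prob_space by simp
    also have "\<dots> = (\<integral>z. cauchy_density z *\<^sub>R iexp (t * z) \<partial>lborel)" by (rule char_cauchy[symmetric])
    also have "\<dots> = char (density lborel (\<lambda>z. ennreal (cauchy_density z))) t"
      unfolding char_def
      by (subst integral_density) (auto simp: cauchy_density_def[abs_def])
    finally show ?thesis .
  qed
  then have "distr M borel Z = density lborel (\<lambda>z. ennreal (cauchy_density z))"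
    by (intro Levy_uniqueness real_distribution_cauchy real_distribution_distr) auto
  moreover have "distr M lborel Z = distr M borel Z" by (rule distr_cong) auto
  ultimately show ?thesis
    unfolding distributed_def Z_def[symmetric] by (simp add: cauchy_density_def[abs_def])
qed

end
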